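(* Suppose $a,c\in\mathbb{R}\setminus\mathbb{N}^0$ with $c-a-1\in\mathbb{R}\setminus\mathbb{N}^{-1}$, and $b\in\mathbb{R}$ with $c-a-b-1\in\mathbb{R}\setminus\mathbb{N}^{-1}$. Then for every $m\in\mathbb{N}_0$, $$\frac{(c-a)_m(c-b)_m}{(c)_m(c-a-b)_m}={_3F_2}(a,b,-m;\,c,\,1+a+b-c-m;\,1).$$
   Context: $\mathbb{N}_0=\{0,1,2,\ldots\}$; $\mathbb{N}^0=\{\ldots,-2,-1,0\}$ is the set of non-positive integers; $\mathbb{N}^{-1}=\{\ldots,-3,-2,-1\}$ is the set of negative integers. For $x\in\mathbb{R}$ and an integer $k\ge 0$, the Pochhammer symbol is $(x)_k=x(x+1)\cdots(x+k-1)$ for $k\geq 1$ and $(x)_0=1$. The hypergeometric function is $${_3F_2}(a_1,a_2,a_3;b_1,b_2;z)=\sum_{k=0}^\infty\frac{(a_1)_k(a_2)_k(a_3)_k}{(b_1)_k(b_2)_k}\frac{z^k}{k!}$$ when the series converges. When a numerator parameter is $-m$ with $m\in\mathbb{N}_0$, one has $(-m)_k=0$ for $k>m$, and the series is understood as the finite sum over $k=0,1,\ldots,m$. *)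

theory Defs
  imports "HOL-Analysis.Analysis"
begin

text \<open>
  The value at \<open>z\<close> of the hypergeometric series with three numerator and two denominator
  parameters; the last argument of \<^const>\<open>fps_hypergeo\<close> is a scaling of the variable, hence \<open>1\<close>.
\<close>
definition hypergeo_3F2 :: "real \<Rightarrow> real \<Rightarrow> real \<Rightarrow> real \<Rightarrow> real \<Rightarrow> real \<Rightarrow> real" where
  "hypergeo_3F2 a1 a2 a3 b1 b2 z = eval_fps (fps_hypergeo [a1, a2, a3] [b1, b2] 1) z"

lemma hypergeo_3F2_altdef:
  "hypergeo_3F2 a1 a2 a3 b1 b2 z =
     (\<Sum>k. pochhammer a1 k * pochhammer a2 k * pochhammer a3 k
          / (pochhammer b1 k * pochhammer b2 k) * (z ^ k / fact k))"
  by (simp add: hypergeo_3F2_def eval_fps_def fps_hypergeo_nth)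

text \<open>
  With a numerator parameter \<open>- m\<close> the terms beyond \<open>m\<close> vanish, since \<open>x / 0 = 0\<close>, even where
  the denominator vanishes too; so the terminating series is the finite sum.
\<close>
lemma hypergeo_3F2_terminating:
  "hypergeo_3F2 a1 a2 (- real m) b1 b2 z =
     (\<Sum>k\<le>m. pochhammer a1 k * pochhammer a2 k * pochhammer (- real m) k
            / (pochhammer b1 k * pochhammer b2 k) * (z ^ k / fact k))"
  unfolding hypergeo_3F2_altdef
  by (rule suminf_finite) (auto simp: pochhammer_of_nat_eq_0_lemma)

end

theory Submission
  imports Defs
begin

text \<open>
  The identity is the Pfaff--Saalschuetz summation. Put \<open>d = c - a - b\<close>. Reversing Pochhammer symbols
  gives \<open>(-m)\<^sub>k = (-1)\<^sup>k m!/(m-k)!\<close> and \<open>(1-d-m)\<^sub>k = (-1)\<^sup>k (d)\<^sub>m/(d)\<^sub>m\<^sub>-\<^sub>k\<close>, so multiplication by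
  \<open>(c)\<^sub>m (d)\<^sub>m\<close> clears all denominators of the series and leaves
  \<open>(c-a)\<^sub>m (c-b)\<^sub>m = (\<Sum>k\<le>m. (m choose k) (a)\<^sub>k (b)\<^sub>k (d)\<^sub>m\<^sub>-\<^sub>k (c+k)\<^sub>m\<^sub>-\<^sub>k)\<close>,
  an identity between polynomials with integer coefficients (\<open>saalschuetz_polynomial\<close>).

  Write \<open>S\<^sub>m\<close> for its right-hand side. The left-hand side grows by the factor
  \<open>(c-a+m)(c-b+m)\<close> when \<open>m\<close> does, so it suffices that
  \<open>S\<^sub>m\<^sub>+\<^sub>1 - (c-a+m)(c-b+m) S\<^sub>m = 0\<close>. Once Pascal's rule has brought \<open>S\<^sub>m\<^sub>+\<^sub>1\<close> to a sum over
  \<open>k \<le> m\<close>, each summand of this difference is \<open>G(k+1) - G(k)\<close>, where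
  \<open>G(k) = k (m choose k) (a)\<^sub>k (b)\<^sub>k (d)\<^sub>m\<^sub>+\<^sub>1\<^sub>-\<^sub>k (c+k)\<^sub>m\<^sub>-\<^sub>k\<close>
  (\<open>saalschuetz_telescoping\<close>); and \<open>G(0) = G(m+1) = 0\<close>.
\<close>

lemma sum_choose_Suc:
  fixes f :: "nat \<Rightarrow> 'a::comm_semiring_1"
  shows "(\<Sum>k\<le>Suc m. of_nat (Suc m choose k) * f k) = (\<Sum>k\<le>m. of_nat (m choose k) * (f k + f (Suc k)))"
proof -
  have "(\<Sum>k\<le>Suc m. of_nat (Suc m choose k) * f k)
      = f 0 + (\<Sum>k\<le>m. of_nat (m choose Suc k) * f (Suc k)) + (\<Sum>k\<le>m. of_nat (m choose k) * f (Suc k))"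
    by (subst sum.atMost_Suc_shift) (simp add: algebra_simps sum.distrib)
  also have "f 0 + (\<Sum>k\<le>m. of_nat (m choose Suc k) * f (Suc k))
      = (\<Sum>k\<le>Suc m. of_nat (m choose k) * f k)"
    by (subst sum.atMost_Suc_shift) simp
  also have "\<dots> = (\<Sum>k\<le>m. of_nat (m choose k) * f k)"
    by (simp add: binomial_eq_0)
  finally show ?thesis
    by (simp add: algebra_simps sum.distrib)
qed

text \<open>
  For \<open>k < m\<close> all terms share the factor
  \<open>(m choose k) (a)\<^sub>k (b)\<^sub>k (d)\<^sub>m\<^sub>-\<^sub>k (c+k+1)\<^sub>m\<^sub>-\<^sub>k\<^sub>-\<^sub>1\<close>; what remains is an identity between
  polynomials in \<open>a, b, c, m, k\<close>, both sides being \<open>(m-k)(c-a)(c-b) - m d (c+k)\<close>.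
  The certificate \<open>G\<close> carries \<open>k (m choose k)\<close> so that it vanishes at both ends of the sum.
\<close>
lemma saalschuetz_telescoping:
  fixes a b c :: "'a::comm_ring_1"
  assumes "k \<le> m"
  defines "d \<equiv> c - a - b"
  defines "t \<equiv> \<lambda>m k. pochhammer a k * pochhammer b k * pochhammer d (m - k) * pochhammer (c + of_nat k) (m - k)"
  defines "G \<equiv> \<lambda>k. of_nat (k * (m choose k)) * (pochhammer a k * pochhammer b k *
                     pochhammer d (Suc m - k) * pochhammer (c + of_nat k) (m - k))"
  shows "of_nat (m choose k) * (t (Suc m) k + t (Suc m) (Suc k))
           - (c - a + of_nat m) * (c - b + of_nat m) * (of_nat (m choose k) * t m k) = G (Suc k) - G k"
proof (cases "k = m")
  case True
  then show ?thesis
    by (simp add: t_def G_def d_def pochhammer_Suc binomial_eq_0 algebra_simps)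
next
  case False
  with assms(1) obtain j where m: "m = k + Suc j"
    by (metis add_Suc_right le_neq_implies_less less_iff_Suc_add)
  define x where "x = pochhammer (c + of_nat k + 1) j"
  define B :: 'a where "B = of_nat (m choose k)"
  have c0: "pochhammer (c + of_nat k) (Suc j) = (c + of_nat k) * x"
    by (simp only: x_def pochhammer_rec)
  have c1: "pochhammer (c + of_nat k + 1) (Suc j) = x * (c + of_nat k + 1 + of_nat j)"
    by (simp only: x_def pochhammer_Suc)
  have c2: "pochhammer (c + of_nat k) (Suc (Suc j)) = (c + of_nat k) * (x * (c + of_nat k + 1 + of_nat j))"
    by (simp only: pochhammer_rec[of _ "Suc j"] c1)
  have "Suc k * (m choose Suc k) = (m choose k) * Suc j"
    by (simp only: binomial_absorption binomial_absorb_comp[symmetric] m diff_add_inverse mult.commute)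
  then have binom: "of_nat (Suc k * (m choose Suc k)) = B * (1 + of_nat j)"
    by (simp only: B_def of_nat_mult of_nat_Suc)
  define y where "y = B * pochhammer a k * pochhammer b k * pochhammer d (Suc j) * x"
  have diffs: "Suc m - k = Suc (Suc j)" "Suc m - Suc k = Suc j" "m - k = Suc j" "m - Suc k = j"
    by (simp_all add: m)
  have shift: "c + of_nat (Suc k) = c + of_nat k + 1"
    by simp
  have e1: "B * t (Suc m) k = y * (d + 1 + of_nat j) * (c + of_nat k) * (c + of_nat m)"
    unfolding t_def diffs c2 pochhammer_Suc[of d "Suc j"] y_def by (simp add: m algebra_simps)
  have e2: "B * t (Suc m) (Suc k) = y * (a + of_nat k) * (b + of_nat k) * (c + of_nat m)"
    unfolding t_def diffs shift c1 pochhammer_Suc[of a] pochhammer_Suc[of b] y_def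
    by (simp add: m algebra_simps)
  have e3: "B * t m k = y * (c + of_nat k)"
    unfolding t_def diffs c0 y_def by (simp add: algebra_simps)
  have e4: "G (Suc k) = y * (1 + of_nat j) * (a + of_nat k) * (b + of_nat k)"
    unfolding G_def diffs shift binom pochhammer_Suc[of a] pochhammer_Suc[of b] y_def x_def
    by (simp add: algebra_simps)
  have e5: "G k = y * of_nat k * (d + 1 + of_nat j) * (c + of_nat k)"
    unfolding G_def diffs c0 pochhammer_Suc[of d "Suc j"] y_def B_def by (simp add: algebra_simps)
  show ?thesis
    unfolding B_def[symmetric] distrib_left[of B] e1 e2 e3 e4 e5 by (simp add: d_def m algebra_simps)
qed

lemma saalschuetz_polynomial:
  fixes a b c :: "'a::comm_ring_1"
  shows "pochhammer (c - a) m * pochhammer (c - b) m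
    = (\<Sum>k\<le>m. of_nat (m choose k) * (pochhammer a k * pochhammer b k *
                 pochhammer (c - a - b) (m - k) * pochhammer (c + of_nat k) (m - k)))"
proof (induction m)
  case 0
  show ?case by simp
next
  case (Suc m)
  define t where "t = (\<lambda>m k. pochhammer a k * pochhammer b k *
                 pochhammer (c - a - b) (m - k) * pochhammer (c + of_nat k) (m - k))"
  define G where "G = (\<lambda>k. of_nat (k * (m choose k)) * (pochhammer a k * pochhammer b k *
                 pochhammer (c - a - b) (Suc m - k) * pochhammer (c + of_nat k) (m - k)))"
  define q where "q = (c - a + of_nat m) * (c - b + of_nat m)"
  have "(\<Sum>k\<le>Suc m. of_nat (Suc m choose k) * t (Suc m) k)
          - q * (\<Sum>k\<le>m. of_nat (m choose k) * t m k)
      = (\<Sum>k\<le>m. of_nat (m choose k) * (t (Suc m) k + t (Suc m) (Suc k))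
                 - q * (of_nat (m choose k) * t m k))"
    unfolding sum_choose_Suc sum_distrib_left sum_subtractf ..
  also have "\<dots> = (\<Sum>k\<le>m. G (Suc k) - G k)"
    unfolding q_def t_def G_def by (intro sum.cong refl saalschuetz_telescoping) simp
  also have "\<dots> = (\<Sum>k<Suc m. G (Suc k) - G k)"
    by (simp only: lessThan_Suc_atMost)
  also have "\<dots> = G (Suc m) - G 0"
    by (rule sum_lessThan_telescope)
  also have "\<dots> = 0"
    by (simp add: G_def binomial_eq_0)
  finally have "(\<Sum>k\<le>Suc m. of_nat (Suc m choose k) * t (Suc m) k)
      = q * (\<Sum>k\<le>m. of_nat (m choose k) * t m k)"
    by simp
  also have "\<dots> = q * (pochhammer (c - a) m * pochhammer (c - b) m)"
    using Suc.IH by (simp add: t_def)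
  also have "\<dots> = pochhammer (c - a) (Suc m) * pochhammer (c - b) (Suc m)"
    by (simp add: q_def pochhammer_Suc algebra_simps)
  finally show ?case
    by (simp only: t_def)
qed

lemma pochhammer_reverse:
  fixes d :: "'a::comm_ring_1"
  assumes "k \<le> m"
  shows "pochhammer (1 - d - of_nat m) k * pochhammer d (m - k) = (-1) ^ k * pochhammer d m"
proof -
  have "pochhammer (1 - d - of_nat m) k = (-1) ^ k * pochhammer (d + of_nat (m - k)) k"
    using pochhammer_minus[of "d + of_nat m - 1" k] assms by (simp add: algebra_simps of_nat_diff)
  then show ?thesis
    using pochhammer_product[of "m - k" m d] assms by simp
qed

text \<open>
  This is where the parameter \<open>1 - d - m\<close> is used: its symbol is a quotient of symbols of \<open>d\<close>
  with the same factor \<open>(-1)\<^sup>k\<close> as in \<open>(-m)\<^sub>k\<close>, so the signs cancel, and \<open>m!/((m-k)! k!)\<close> is left.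
\<close>
lemma pochhammer_quotient_binomial:
  fixes d :: "'a::field_char_0"
  assumes "k \<le> m" and "pochhammer d m \<noteq> 0"
  shows "pochhammer (- of_nat m) k / (pochhammer (1 - d - of_nat m) k * fact k)
           = of_nat (m choose k) * pochhammer d (m - k) / pochhammer d m"
proof -
  have rev: "pochhammer (1 - d - of_nat m) k * pochhammer d (m - k) = (-1) ^ k * pochhammer d m"
    using assms(1) by (rule pochhammer_reverse)
  with assms(2) have nz: "pochhammer (1 - d - of_nat m) k \<noteq> 0"
    by (metis mult_eq_0_iff power_eq_0_iff neg_equal_0_iff_equal one_neq_zero)
  have "pochhammer (- of_nat m :: 'a) k = (-1) ^ k * (of_nat (m choose k) * fact k)"
    by (simp add: binomial_gbinomial gbinomial_pochhammer)
  moreover have "(-1) ^ k * ((-1) ^ k * pochhammer d m) = pochhammer d m"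
    by (simp flip: mult.assoc power_mult_distrib)
  ultimately show ?thesis
    using nz assms(2) rev by (simp add: field_simps)
qed

theorem corollary3p12:
  fixes a b c :: real and m :: nat
  assumes "a \<notin> \<int>\<^sub>\<le>\<^sub>0" and "c \<notin> \<int>\<^sub>\<le>\<^sub>0"
    and "c - a - 1 \<notin> {x \<in> \<int>. x < 0}"
    and "c - a - b - 1 \<notin> {x \<in> \<int>. x < 0}"
  shows "pochhammer (c - a) m * pochhammer (c - b) m / (pochhammer c m * pochhammer (c - a - b) m)
    = hypergeo_3F2 a b (- real m) c (1 + a + b - c - real m) 1"
proof -
  define d where "d = c - a - b"
  have c_nz: "pochhammer c k \<noteq> 0" for k
    using assms(2) by (auto simp: pochhammer_eq_0_iff)
  have "d \<noteq> - real n" for n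
    using assms(4) by (auto simp: d_def)
  then have d_nz: "pochhammer d m \<noteq> 0"
    by (auto simp: pochhammer_eq_0_iff)
  have "hypergeo_3F2 a b (- real m) c (1 - d - real m) 1
      = (\<Sum>k\<le>m. pochhammer a k * pochhammer b k / pochhammer c k
          * (pochhammer (- real m) k / (pochhammer (1 - d - real m) k * fact k)))"
    by (simp add: hypergeo_3F2_terminating mult.assoc)
  also have "\<dots> = (\<Sum>k\<le>m. pochhammer a k * pochhammer b k / pochhammer c k
          * (real (m choose k) * pochhammer d (m - k) / pochhammer d m))"
    using d_nz by (intro sum.cong refl arg_cong2[where f = "(*)"] pochhammer_quotient_binomial) auto
  also have "\<dots> = (\<Sum>k\<le>m. real (m choose k) * (pochhammer a k * pochhammer b k *
          pochhammer d (m - k) * pochhammer (c + real k) (m - k)) / (pochhammer c m * pochhammer d m))"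
  proof (intro sum.cong refl)
    fix k assume "k \<in> {..m}"
    then have split: "pochhammer c m = pochhammer c k * pochhammer (c + real k) (m - k)"
      using pochhammer_product[of k m c] by simp
    with c_nz[of m] have "pochhammer (c + real k) (m - k) \<noteq> 0"
      by auto
    then show "pochhammer a k * pochhammer b k / pochhammer c k
          * (real (m choose k) * pochhammer d (m - k) / pochhammer d m)
        = real (m choose k) * (pochhammer a k * pochhammer b k *
          pochhammer d (m - k) * pochhammer (c + real k) (m - k)) / (pochhammer c m * pochhammer d m)"
      using c_nz[of k] d_nz unfolding split by (simp add: field_simps)
  qed
  also have "\<dots> = pochhammer (c - a) m * pochhammer (c - b) m / (pochhammer c m * pochhammer d m)"
    unfolding saalschuetz_polynomial[of c a m b] d_def by (simp only: sum_divide_distrib)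
  finally have "pochhammer (c - a) m * pochhammer (c - b) m / (pochhammer c m * pochhammer d m)
      = hypergeo_3F2 a b (- real m) c (1 - d - real m) 1"
    by (rule sym)
  moreover have "1 - d - real m = 1 + a + b - c - real m"
    by (simp add: d_def)
  ultimately show ?thesis
    by (simp only: d_def)
qed

end
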